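(* Let $F$ be a field of characteristic $0$, $\tilde H$ a connected linear algebraic group over $F$, and $V$ a regular irreducible representation of $\tilde H$ defined over $F$. Then for all subspaces $W,W'\subseteq V$ there exists $\tilde h\in\tilde H$ such that $$\dim\bigl[(\tilde h.W)\cap W'\bigr]\le\frac{\dim W}{\dim V}\dim W'.$$ Moreover, the set of such $\tilde h$ forms a Zariski open subset of $\tilde H$.
   Context: Irreducible means $V$ has no $\tilde H$-invariant subspace other than $0$ and $V$. *)

theory Defs
  imports "HOL-Analysis.Analysis"
begin

inductive_set matrix_polyfun :: "(('a::comm_ring_1)^'n^'n \<Rightarrow> 'a) set" where
  const: "(\<lambda>x. c) \<in> matrix_polyfun"
| entry: "(\<lambda>x. x $ i $ j) \<in> matrix_polyfun"
| add: "p \<in> matrix_polyfun \<Longrightarrow> q \<in> matrix_polyfun \<Longrightarrow> (\<lambda>x. p x + q x) \<in> matrix_polyfun"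
| mult: "p \<in> matrix_polyfun \<Longrightarrow> q \<in> matrix_polyfun \<Longrightarrow> (\<lambda>x. p x * q x) \<in> matrix_polyfun"

definition zariski_closed :: "(('a::comm_ring_1)^'n^'n) set \<Rightarrow> bool" where
  "zariski_closed S \<longleftrightarrow> (\<exists>P \<subseteq> matrix_polyfun. S = {x. \<forall>p\<in>P. p x = 0})"

definition zariski :: "(('a::comm_ring_1)^'n^'n) topology" where
  "zariski = topology (\<lambda>U. zariski_closed (- U))"

text \<open>A linear algebraic group over F: a Zariski closed subgroup of GL_n(F)
  (i.e. the F-points of a closed subgroup of GL_n defined over F).\<close>
definition linear_algebraic_group :: "(('a::field)^'n^'n) set \<Rightarrow> bool" where
  "linear_algebraic_group H \<longleftrightarrow>
     (\<exists>P \<subseteq> matrix_polyfun. H = {g. det g \<noteq> 0 \<and> (\<forall>p\<in>P. p g = 0)}) \<and>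
     mat 1 \<in> H \<and>
     (\<forall>g\<in>H. \<forall>h\<in>H. g ** h \<in> H) \<and>
     (\<forall>g\<in>H. \<exists>g'\<in>H. g ** g' = mat 1 \<and> g' ** g = mat 1)"

text \<open>Regular functions on H: restrictions of regular functions on GL_n,
  i.e. of the form p(g)/det(g)^k with p polynomial.\<close>
definition regular_fun_on :: "(('a::field)^'n^'n) set \<Rightarrow> ('a^'n^'n \<Rightarrow> 'a) \<Rightarrow> bool" where
  "regular_fun_on H f \<longleftrightarrow>
     (\<exists>p\<in>matrix_polyfun. \<exists>k::nat. \<forall>g\<in>H. f g = p g / (det g) ^ k)"

definition regular_rep :: "(('a::field)^'n^'n) set \<Rightarrow> ('a^'n^'n \<Rightarrow> 'a^'m^'m) \<Rightarrow> bool" where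
  "regular_rep H \<rho> \<longleftrightarrow>
     (\<forall>g\<in>H. det (\<rho> g) \<noteq> 0) \<and>
     (\<forall>g\<in>H. \<forall>h\<in>H. \<rho> (g ** h) = \<rho> g ** \<rho> h) \<and>
     (\<forall>i j. regular_fun_on H (\<lambda>g. \<rho> g $ i $ j))"

definition irreducible_rep :: "(('a::field)^'n^'n) set \<Rightarrow> ('a^'n^'n \<Rightarrow> 'a^'m^'m) \<Rightarrow> bool" where
  "irreducible_rep H \<rho> \<longleftrightarrow>
     (\<forall>U. vec.subspace U \<and> (\<forall>h\<in>H. \<forall>u\<in>U. \<rho> h *v u \<in> U) \<longrightarrow> U = {0} \<or> U = UNIV)"

end

theory Submission
  imports Defs
begin

text \<open>
  Let \<open>f A\<close> be the minimum over \<open>h\<close> of \<open>dim (hW \<inter> A)\<close>. If any two nonempty open conditions of the form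
  \<open>dim (hW \<inter> A) \<le> k\<close> can be satisfied simultaneously, then evaluating at an \<open>h\<close> that is generic for
  both \<open>A + B\<close> and \<open>A \<inter> B\<close> shows that \<open>f\<close> is supermodular. Hence the largest maximiser of
  \<open>dim V * f A - dim W * dim A\<close> is unique, so it is invariant, so it is \<open>0\<close> or \<open>V\<close>, where the value
  is \<open>0\<close>.

  Irreducibility of the connected group is obtained without Hilbert's basis theorem: only closed sets
  cut out by the functions \<open>h \<mapsto> det (P ** \<rho> h ** Q + N)\<close> matter. These functions span a
  finite-dimensional space, which gives the descending chain condition, and they are stable under
  left translation, which makes the irreducible components disjoint.
\<close>

section \<open>The Zariski topology and regular functions\<close>

lemma zariski_closed_empty: "zariski_closed {}"
  unfolding zariski_closed_def
  by (intro exI[of _ "{\<lambda>x. 1}"]) (auto intro: matrix_polyfun.const)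

lemma zariski_closed_Inter:
  assumes "\<And>S. S \<in> \<S> \<Longrightarrow> zariski_closed S"
  shows "zariski_closed (\<Inter>\<S>)"
proof -
  \<comment> \<open>Taking every polynomial that vanishes on the intersection avoids choosing
    equations for each member.\<close>
  let ?P = "{p \<in> matrix_polyfun. \<forall>x\<in>\<Inter>\<S>. p x = 0}"
  have "x \<in> S" if x: "\<forall>p\<in>?P. p x = 0" and S: "S \<in> \<S>" for x S
  proof -
    obtain P where "P \<subseteq> matrix_polyfun" "S = {x. \<forall>p\<in>P. p x = 0}"
      using assms[OF S] unfolding zariski_closed_def by auto
    then show ?thesis using x S by blast
  qed
  then have "\<Inter>\<S> = {x. \<forall>p\<in>?P. p x = 0}" by blast
  then show ?thesis unfolding zariski_closed_def by (intro exI[of _ ?P]) auto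
qed

text \<open>Products of one equation from each set cut out the union: at a point outside both sets
  some product is nonzero, since there are no zero divisors.\<close>

lemma zariski_closed_Un:
  fixes S T :: "('a::idom^'n^'n) set"
  assumes "zariski_closed S" "zariski_closed T"
  shows "zariski_closed (S \<union> T)"
proof -
  obtain P Q where PQ: "P \<subseteq> matrix_polyfun" "S = {x. \<forall>p\<in>P. p x = 0}"
      "Q \<subseteq> matrix_polyfun" "T = {x. \<forall>q\<in>Q. q x = 0}"
    using assms unfolding zariski_closed_def by auto
  have "S \<union> T = {x. \<forall>r\<in>{\<lambda>x. p x * q x | p q. p \<in> P \<and> q \<in> Q}. r x = 0}"
    unfolding PQ by fastforce
  moreover have "{\<lambda>x. p x * q x | p q. p \<in> P \<and> q \<in> Q} \<subseteq> matrix_polyfun"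
    using PQ by (auto intro!: matrix_polyfun.mult)
  ultimately show ?thesis
    unfolding zariski_closed_def by blast
qed

lemma openin_zariski: "openin zariski U \<longleftrightarrow> zariski_closed (- U)"
  for U :: "('a::idom^'n^'n) set"
proof -
  have "istopology (\<lambda>U. zariski_closed (- U :: ('a^'n^'n) set))"
    unfolding istopology_def
  proof (intro conjI allI impI)
    fix S T :: "('a^'n^'n) set"
    assume "zariski_closed (- S)" "zariski_closed (- T)"
    then show "zariski_closed (- (S \<inter> T))"
      by (simp add: zariski_closed_Un)
  next
    fix \<K> :: "('a^'n^'n) set set"
    assume "\<forall>K\<in>\<K>. zariski_closed (- K)"
    then show "zariski_closed (- \<Union>\<K>)"
      using zariski_closed_Inter[of "uminus ` \<K>"] by (auto simp: uminus_Sup)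
  qed
  then show ?thesis
    unfolding zariski_def by (simp add: topology_inverse')
qed

lemma topspace_zariski [simp]: "topspace (zariski :: ('a::idom^'n^'n) topology) = UNIV"
proof -
  have "openin zariski (UNIV :: ('a^'n^'n) set)"
    by (simp add: openin_zariski zariski_closed_empty)
  then show ?thesis
    using openin_subset by blast
qed

lemma closedin_zariski: "closedin zariski S \<longleftrightarrow> zariski_closed S"
  for S :: "('a::idom^'n^'n) set"
  by (simp add: closedin_def openin_zariski Compl_eq_Diff_UNIV[symmetric])

section \<open>Polynomial and regular functions on matrices\<close>

lemma matrix_polyfun_sum:
  "finite I \<Longrightarrow> (\<And>i. i \<in> I \<Longrightarrow> p i \<in> matrix_polyfun) \<Longrightarrow> (\<lambda>x. \<Sum>i\<in>I. p i x) \<in> matrix_polyfun"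
  by (induction I rule: finite_induct) (auto intro: matrix_polyfun.intros)

lemma matrix_polyfun_prod:
  "finite I \<Longrightarrow> (\<And>i. i \<in> I \<Longrightarrow> p i \<in> matrix_polyfun) \<Longrightarrow> (\<lambda>x. \<Prod>i\<in>I. p i x) \<in> matrix_polyfun"
  by (induction I rule: finite_induct) (auto intro: matrix_polyfun.intros)

lemma matrix_polyfun_power:
  "p \<in> matrix_polyfun \<Longrightarrow> (\<lambda>x. p x ^ k) \<in> matrix_polyfun"
  by (induction k) (auto intro: matrix_polyfun.intros)

lemma matrix_polyfun_det: "det \<in> matrix_polyfun"
proof -
  have "(\<lambda>x. det x) \<in> matrix_polyfun"
    unfolding det_def
    by (intro matrix_polyfun_sum matrix_polyfun.mult matrix_polyfun.const matrix_polyfun_prod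
        matrix_polyfun.entry) auto
  then show ?thesis by simp
qed

lemma regular_fun_on_const: "regular_fun_on H (\<lambda>g. c)"
  unfolding regular_fun_on_def
  by (rule bexI[OF _ matrix_polyfun.const[of c]]) (auto intro: exI[of _ 0])

lemma regular_fun_on_mult:
  assumes "regular_fun_on H f" "regular_fun_on H f'"
  shows "regular_fun_on H (\<lambda>g. f g * f' g)"
proof -
  obtain p k p' k' where p: "p \<in> matrix_polyfun" "\<forall>g\<in>H. f g = p g / det g ^ k"
      "p' \<in> matrix_polyfun" "\<forall>g\<in>H. f' g = p' g / det g ^ k'"
    using assms unfolding regular_fun_on_def by blast
  show ?thesis
    unfolding regular_fun_on_def
    by (rule bexI[OF _ matrix_polyfun.mult[OF p(1,3)]], rule exI[of _ "k + k'"])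
      (use p in \<open>simp add: power_add\<close>)
qed

lemma regular_fun_on_add:
  assumes "\<forall>g\<in>H. det g \<noteq> 0" and "regular_fun_on H f" "regular_fun_on H f'"
  shows "regular_fun_on H (\<lambda>g. f g + f' g)"
proof -
  obtain p k p' k' where p: "p \<in> matrix_polyfun" "\<forall>g\<in>H. f g = p g / det g ^ k"
      "p' \<in> matrix_polyfun" "\<forall>g\<in>H. f' g = p' g / det g ^ k'"
    using assms unfolding regular_fun_on_def by blast
  have "(\<lambda>g. p g * det g ^ k' + p' g * det g ^ k) \<in> matrix_polyfun"
    using p by (intro matrix_polyfun.intros matrix_polyfun_power matrix_polyfun_det)
  then show ?thesis
    unfolding regular_fun_on_def
    by (rule bexI[rotated], intro exI[of _ "k + k'"])
      (use p assms(1) in \<open>simp add: power_add field_simps\<close>)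
qed

lemma regular_fun_on_sum:
  assumes "\<forall>g\<in>H. det g \<noteq> 0" and "finite I" and "\<And>i. i \<in> I \<Longrightarrow> regular_fun_on H (f i)"
  shows "regular_fun_on H (\<lambda>g. \<Sum>i\<in>I. f i g)"
  using assms(2,3)
  by (induction I rule: finite_induct) (auto intro!: regular_fun_on_const regular_fun_on_add[OF assms(1)])

lemma regular_fun_on_prod:
  assumes "finite I" and "\<And>i. i \<in> I \<Longrightarrow> regular_fun_on H (f i)"
  shows "regular_fun_on H (\<lambda>g. \<Prod>i\<in>I. f i g)"
  using assms
  by (induction I rule: finite_induct) (auto intro: regular_fun_on_const regular_fun_on_mult)

text \<open>On \<open>H\<close> the determinant is nonzero, so a regular function vanishes exactly
  where its numerator does.\<close>

lemma zariski_closed_regular_zeros: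
  fixes H :: "('a::field^'n^'n) set"
  assumes "\<forall>g\<in>H. det g \<noteq> 0" and "\<forall>f\<in>S. regular_fun_on H f"
  shows "\<exists>Z. zariski_closed Z \<and> {h\<in>H. \<forall>f\<in>S. f h = 0} = H \<inter> Z"
proof -
  obtain p k where p: "\<And>f. f \<in> S \<Longrightarrow> p f \<in> matrix_polyfun \<and> (\<forall>g\<in>H. f g = p f g / det g ^ k f)"
    using assms(2) unfolding regular_fun_on_def by metis
  have "{h\<in>H. \<forall>f\<in>S. f h = 0} = H \<inter> {x. \<forall>q\<in>p ` S. q x = 0}"
    using p assms(1) by force
  moreover have "zariski_closed {x. \<forall>q\<in>p ` S. q x = 0}"
    unfolding zariski_closed_def using p by blast
  ultimately show ?thesis by blast
qed

section \<open>Irreducible decompositions in homogeneous spaces\<close>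

text \<open>The family is not assumed closed under unions, so arbitrary finite covers replace the
  usual covers by two sets. The empty cover excludes the empty set.\<close>

definition irreducible_in :: "'a set set \<Rightarrow> 'a set \<Rightarrow> bool" where
  "irreducible_in \<C> X \<longleftrightarrow> X \<in> \<C> \<and> (\<forall>F. finite F \<longrightarrow> F \<subseteq> \<C> \<longrightarrow> X \<subseteq> \<Union>F \<longrightarrow> (\<exists>A\<in>F. X \<subseteq> A))"

lemma irreducible_in_nonempty: "irreducible_in \<C> X \<Longrightarrow> X \<noteq> {}"
  unfolding irreducible_in_def by (metis all_not_in_conv empty_subsetI finite.emptyI)

text \<open>Noetherian induction, with \<open>\<mu>\<close> in place of the descending chain
  condition: a reducible \<open>A\<close> has a finite cover no member of which contains it, so
  intersecting \<open>A\<close> with each member gives strictly smaller sets.\<close>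

lemma finite_irreducible_decomposition:
  fixes \<mu> :: "'a set \<Rightarrow> nat"
  assumes Int: "\<And>A B. A \<in> \<C> \<Longrightarrow> B \<in> \<C> \<Longrightarrow> A \<inter> B \<in> \<C>"
    and mono: "\<And>A B. A \<in> \<C> \<Longrightarrow> B \<in> \<C> \<Longrightarrow> A \<subset> B \<Longrightarrow> \<mu> A < \<mu> B"
  shows "A \<in> \<C> \<Longrightarrow> \<exists>F. finite F \<and> (\<forall>X\<in>F. irreducible_in \<C> X) \<and> A = \<Union>F"
proof (induction "\<mu> A" arbitrary: A rule: less_induct)
  case less
  show ?case
  proof (cases "irreducible_in \<C> A")
    case True
    then show ?thesis by (intro exI[of _ "{A}"]) auto
  next
    case False
    then obtain F where F: "finite F" "F \<subseteq> \<C>" "A \<subseteq> \<Union>F" "\<And>B. B \<in> F \<Longrightarrow> \<not> A \<subseteq> B"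
      using less.prems unfolding irreducible_in_def by blast
    have "\<exists>G. finite G \<and> (\<forall>X\<in>G. irreducible_in \<C> X) \<and> A \<inter> B = \<Union>G" if "B \<in> F" for B
      using that F less.prems by (intro less.hyps mono Int) auto
    then obtain G where G: "\<And>B. B \<in> F \<Longrightarrow> finite (G B) \<and> (\<forall>X\<in>G B. irreducible_in \<C> X) \<and> A \<inter> B = \<Union>(G B)"
      by metis
    have "A = (\<Union>B\<in>F. A \<inter> B)" using F by auto
    also have "\<dots> = \<Union>(\<Union>B\<in>F. G B)" using G by auto
    finally show ?thesis using F(1) G by (intro exI[of _ "\<Union>B\<in>F. G B"]) auto
  qed
qed

text \<open>A maximal irreducible member is not covered by the other ones, so some point lies on exactly
  one of them; by homogeneity every point does.\<close>

lemma disjoint_irreducible_decomposition: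
  fixes \<mu> :: "'a set \<Rightarrow> nat"
  assumes Int: "\<And>A B. A \<in> \<C> \<Longrightarrow> B \<in> \<C> \<Longrightarrow> A \<inter> B \<in> \<C>"
    and mono: "\<And>A B. A \<in> \<C> \<Longrightarrow> B \<in> \<C> \<Longrightarrow> A \<subset> B \<Longrightarrow> \<mu> A < \<mu> B"
    and H: "H \<in> \<C>" "\<C> \<subseteq> Pow H"
    and hom: "\<And>x y. x \<in> H \<Longrightarrow> y \<in> H \<Longrightarrow> \<exists>\<sigma> \<tau>. \<sigma> y = x \<and>
        (\<forall>A\<in>\<C>. \<sigma> ` A \<in> \<C> \<and> \<tau> ` A \<in> \<C>) \<and> (\<forall>z\<in>H. \<sigma> (\<tau> z) = z \<and> \<tau> (\<sigma> z) = z)"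
  shows "\<exists>M. finite M \<and> (\<forall>X\<in>M. irreducible_in \<C> X) \<and> H = \<Union>M \<and> disjoint M"
proof -
  let ?irr = "irreducible_in \<C>"
  \<comment> \<open>Maximality is taken among all irreducible members, not just those in the finite
    decomposition, so that the symmetries preserve \<open>M\<close>.\<close>
  define M where "M = {X. ?irr X \<and> (\<forall>Y. ?irr Y \<longrightarrow> X \<subseteq> Y \<longrightarrow> Y = X)}"
  obtain F where F: "finite F" "\<forall>X\<in>F. ?irr X" "H = \<Union>F"
    using finite_irreducible_decomposition[where \<mu> = \<mu>, OF Int mono H(1)] by auto
  have sub: "\<exists>X\<in>F. Y \<subseteq> X" if "?irr Y" for Y
    using that F H unfolding irreducible_in_def by (metis PowD subsetD subsetI)
  have "M \<subseteq> F"
    using sub F(2) unfolding M_def by blast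
  then have finM: "finite M" using F(1) finite_subset by auto
  have cover: "H = \<Union>M"
  proof
    show "\<Union>M \<subseteq> H" using \<open>M \<subseteq> F\<close> F(3) by auto
    show "H \<subseteq> \<Union>M"
    proof
      fix z assume "z \<in> H"
      then obtain X where "X \<in> F" "z \<in> X" using F(3) by auto
      then obtain Y where Y: "Y \<in> F" "X \<subseteq> Y" "\<And>Z. Z \<in> F \<Longrightarrow> Y \<subseteq> Z \<Longrightarrow> Y = Z"
        using finite_has_maximal2[OF F(1)] by metis
      have "Y \<in> M"
        unfolding M_def
      proof (intro CollectI conjI allI impI)
        show "?irr Y" using Y F(2) by auto
        fix Z assume "?irr Z" "Y \<subseteq> Z"
        then show "Z = Y" using sub[of Z] Y(3) by blast
      qed
      then show "z \<in> \<Union>M" using Y \<open>z \<in> X\<close> by auto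
    qed
  qed
  have sym_irr: "?irr (\<sigma> ` X)"
    if "\<forall>A\<in>\<C>. \<sigma> ` A \<in> \<C> \<and> \<tau> ` A \<in> \<C>" "\<forall>z\<in>H. \<sigma> (\<tau> z) = z \<and> \<tau> (\<sigma> z) = z" and irrX: "?irr X" for \<sigma> \<tau> X
    unfolding irreducible_in_def
  proof (intro conjI allI impI)
    have X: "X \<in> \<C>" "X \<subseteq> H" using irrX H unfolding irreducible_in_def by auto
    then show "\<sigma> ` X \<in> \<C>" using that by auto
    fix G assume G: "finite G" "G \<subseteq> \<C>" "\<sigma> ` X \<subseteq> \<Union>G"
    \<comment> \<open>A cover of the image is pulled back along \<open>\<tau>\<close>, which inverts
      \<open>\<sigma>\<close> on \<open>H\<close>.\<close>
    have "X \<subseteq> \<Union>((`) \<tau> ` G)"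
    proof
      fix x assume "x \<in> X"
      then have "\<sigma> x \<in> \<Union>G" "x = \<tau> (\<sigma> x)" using G X that by auto
      then show "x \<in> \<Union>((`) \<tau> ` G)" by (metis UnionE UnionI imageI)
    qed
    moreover have "finite ((`) \<tau> ` G)" "(`) \<tau> ` G \<subseteq> \<C>" using G that by auto
    ultimately obtain A where A: "A \<in> G" "X \<subseteq> \<tau> ` A"
      using irrX unfolding irreducible_in_def by (metis (no_types, lifting) imageE)
    have "A \<subseteq> H" using A G H by auto
    then have "\<sigma> ` X \<subseteq> A" using A that(2) by force
    then show "\<exists>A\<in>G. \<sigma> ` X \<subseteq> A" using A by auto
  qed
  have sym_M: "\<sigma> ` X \<in> M"
    if st: "\<forall>A\<in>\<C>. \<sigma> ` A \<in> \<C> \<and> \<tau> ` A \<in> \<C>" "\<forall>z\<in>H. \<sigma> (\<tau> z) = z \<and> \<tau> (\<sigma> z) = z" and X: "X \<in> M" for \<sigma> \<tau> X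
    unfolding M_def
  proof (intro CollectI conjI allI impI)
    show "?irr (\<sigma> ` X)" using sym_irr[OF st] X unfolding M_def by auto
    fix Y assume Y: "?irr Y" "\<sigma> ` X \<subseteq> Y"
    have sub: "X \<subseteq> H" "Y \<subseteq> H" using X Y H unfolding M_def irreducible_in_def by auto
    have "?irr (\<tau> ` Y)" using sym_irr[of \<tau> \<sigma>] st Y by auto
    moreover have "X \<subseteq> \<tau> ` Y"
    proof
      fix x assume "x \<in> X"
      then have "x = \<tau> (\<sigma> x)" "\<sigma> x \<in> Y" using sub st Y by auto
      then show "x \<in> \<tau> ` Y" by (metis imageI)
    qed
    ultimately have "\<tau> ` Y = X" using X unfolding M_def by auto
    moreover have "\<sigma> ` \<tau> ` Y = (\<lambda>z. z) ` Y"
      unfolding image_image using sub st by (intro image_cong) auto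
    ultimately show "Y = \<sigma> ` X" by simp
  qed
  have "disjoint M"
  proof (rule disjointI, rule ccontr)
    fix X X' assume XX: "X \<in> M" "X' \<in> M" "X \<noteq> X'" "X \<inter> X' \<noteq> {}"
    then obtain y where y: "y \<in> X" "y \<in> X'" by auto
    \<comment> \<open>Otherwise irreducibility would place \<open>X\<close> inside a single other
      member, against maximality.\<close>
    have "\<not> X \<subseteq> \<Union>(M - {X})"
    proof
      assume "X \<subseteq> \<Union>(M - {X})"
      moreover have "?irr X" "finite (M - {X})" "M - {X} \<subseteq> \<C>"
        using XX finM unfolding M_def irreducible_in_def by auto
      ultimately obtain Y where "Y \<in> M - {X}" "X \<subseteq> Y"
        unfolding irreducible_in_def by meson
      then show False using XX unfolding M_def by auto
    qed
    then obtain x where x: "x \<in> X" "\<And>Y. Y \<in> M \<Longrightarrow> x \<in> Y \<Longrightarrow> Y = X" by auto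
    have "x \<in> H" "y \<in> H" using x(1) y XX(1) cover by blast+
    from hom[OF this] obtain \<sigma> \<tau> where st: "\<forall>A\<in>\<C>. \<sigma> ` A \<in> \<C> \<and> \<tau> ` A \<in> \<C>"
        "\<forall>z\<in>H. \<sigma> (\<tau> z) = z \<and> \<tau> (\<sigma> z) = z" "\<sigma> y = x"
      by (elim exE conjE)
    \<comment> \<open>Both images contain \<open>x\<close>, and \<open>X\<close> is the only member
      of \<open>M\<close> that does; injectivity of \<open>\<sigma>\<close> then identifies
      \<open>X\<close> and \<open>X'\<close>.\<close>
    have "\<sigma> ` X = X" "\<sigma> ` X' = X"
      using x(2)[OF sym_M[OF st(1,2) XX(1)]] x(2)[OF sym_M[OF st(1,2) XX(2)]]
        imageI[OF y(1), of \<sigma>] imageI[OF y(2), of \<sigma>] st(3) by blast+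
    moreover have "inj_on \<sigma> H" using st(2) by (metis inj_onI)
    moreover have "X \<subseteq> H" "X' \<subseteq> H" using XX cover by blast+
    ultimately show False using XX(3) by (metis inj_on_image_eq_iff)
  qed
  moreover have "\<forall>X\<in>M. ?irr X" unfolding M_def by auto
  ultimately show ?thesis using finM cover by blast
qed

section \<open>Determinants and subspaces in general position\<close>

text \<open>One slot per row: these finitely many functions include every product met when expanding
  a determinant whose entries are affine in the entries of \<open>R\<close>. \<open>None\<close>
  marks the choice of the constant term.\<close>

definition monomial_eval :: "('m \<Rightarrow> ('m \<times> 'm) option) \<Rightarrow> 'a::comm_ring_1^'m^'m \<Rightarrow> 'a" where
  "monomial_eval t R = (\<Prod>i\<in>UNIV. case t i of None \<Rightarrow> 1 | Some (a, b) \<Rightarrow> R $ a $ b)"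

text \<open>Expand the Leibniz formula and distribute the products over the affine entries. Since
  \<open>c\<close> does not depend on \<open>R\<close>, all these determinants lie in the span of
  one finite family of functions.\<close>

lemma det_affine_monomial_expansion:
  fixes P Q N :: "'a::comm_ring_1^'m^'m"
  shows "\<exists>c. \<forall>R. det (P ** R ** Q + N) = (\<Sum>t\<in>UNIV. c t * monomial_eval t R)"
proof -
  define v where "v R s = (case s of None \<Rightarrow> 1 | Some (a, b) \<Rightarrow> R $ a $ b)"
    for R :: "'a^'m^'m" and s :: "('m \<times> 'm) option"
  define e where "e i j s = (case s of None \<Rightarrow> N $ i $ j | Some (a, b) \<Rightarrow> P $ i $ a * Q $ b $ j)"
    for i j and s :: "('m \<times> 'm) option"
  define c where "c t = (\<Sum>p | p permutes UNIV. of_int (sign p) * (\<Prod>i\<in>UNIV. e i (p i) (t i)))" for t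
  have entry: "(P ** R ** Q + N) $ i $ j = (\<Sum>s\<in>UNIV. e i j s * v R s)" for R i j
  proof -
    have "(P ** R ** Q + N) $ i $ j = N $ i $ j + (\<Sum>b\<in>UNIV. \<Sum>a\<in>UNIV. P $ i $ a * Q $ b $ j * R $ a $ b)"
      by (simp add: matrix_matrix_mult_def sum_distrib_right sum_distrib_left mult_ac)
    also have "(\<Sum>b\<in>UNIV. \<Sum>a\<in>UNIV. P $ i $ a * Q $ b $ j * R $ a $ b)
        = (\<Sum>(a, b)\<in>UNIV. P $ i $ a * Q $ b $ j * R $ a $ b)"
      by (subst sum.swap) (simp add: sum.cartesian_product)
    finally show ?thesis
      by (simp add: UNIV_option_conv sum.reindex e_def v_def case_prod_beta)
  qed
  have "det (P ** R ** Q + N) = (\<Sum>t\<in>UNIV. c t * monomial_eval t R)" for R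
  proof -
    have "det (P ** R ** Q + N)
        = (\<Sum>p | p permutes UNIV. of_int (sign p) * (\<Prod>i\<in>UNIV. \<Sum>s\<in>UNIV. e i (p i) s * v R s))"
      unfolding det_def entry ..
    also have "\<dots> = (\<Sum>p | p permutes UNIV. \<Sum>t\<in>UNIV.
        of_int (sign p) * (\<Prod>i\<in>UNIV. e i (p i) (t i)) * monomial_eval t R)"
      by (subst prod_sum_PiE)
        (auto simp: sum_distrib_left prod.distrib monomial_eval_def v_def mult_ac)
    also have "\<dots> = (\<Sum>t\<in>UNIV. c t * monomial_eval t R)"
      by (subst sum.swap) (simp add: c_def sum_distrib_right)
    finally show ?thesis .
  qed
  then show ?thesis by blast
qed

section \<open>Subspaces in general position\<close>

lemma dim_le_CARD: "vec.dim S \<le> CARD('m)" for S :: "('a::field^'m) set"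
  using vec.dim_subset_UNIV[of S] by (simp add: vec.dimension_def card_cart_basis)

text \<open>Extend a basis of \<open>B\<close> by vectors of \<open>X\<close> to a basis of the
  whole space, and let \<open>N\<close> fix the former and kill the latter. The sum of
  \<open>X\<close> and \<open>B\<close> may fail to be direct.\<close>

lemma exists_projection_matrix:
  fixes B X :: "('a::field^'m) set"
  assumes B: "vec.subspace B" and X: "vec.subspace X"
    and sum: "{x + b | x b. x \<in> X \<and> b \<in> B} = UNIV"
  shows "\<exists>N::'a^'m^'m. range ((*v) N) = B \<and> (\<forall>v. v - N *v v \<in> X)"
proof -
  obtain b where b: "b \<subseteq> B" "vec.independent b" "B \<subseteq> vec.span b"
    using vec.maximal_independent_subset by blast
  then have spanb: "vec.span b = B"
    using B vec.span_minimal by blast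
  obtain e where e: "b \<subseteq> e" "e \<subseteq> b \<union> X" "vec.independent e" "b \<union> X \<subseteq> vec.span e"
    using vec.maximal_independent_subset_extend[of b "b \<union> X"] b(2) by blast
  have spane: "vec.span e = UNIV"
  proof -
    have "x + y \<in> vec.span e" if "x \<in> X" "y \<in> B" for x y
      using that e spanb by (metis UnCI subsetD vec.span_add vec.span_mono)
    then have "{x + b | x b. x \<in> X \<and> b \<in> B} \<subseteq> vec.span e" by auto
    then show ?thesis unfolding sum by auto
  qed
  obtain n where n: "Vector_Spaces.linear (*s) (*s) n" "\<forall>x\<in>e. n x = (if x \<in> b then x else 0)"
    using vec.linear_independent_extend[OF e(3), of "\<lambda>x. if x \<in> b then x else 0"] by blast
  define N where "N = matrix n"
  have N: "N *v v = n v" for v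
    unfolding N_def using n(1) by (rule matrix_works)
  have "range ((*v) N) = vec.span (n ` e)"
    using vec.span_image[of N e] spane by (simp add: N[abs_def])
  also have "vec.span (n ` e) = vec.span b"
  proof
    have "n ` e \<subseteq> insert 0 b" using n by auto
    then show "vec.span (n ` e) \<subseteq> vec.span b"
      by (metis vec.span_insert_0 vec.span_mono)
    have "b \<subseteq> n ` e" using n e by force
    then show "vec.span b \<subseteq> vec.span (n ` e)" by (rule vec.span_mono)
  qed
  finally have range: "range ((*v) N) = B" using spanb by simp
  have sub: "vec.subspace {v. v - N *v v \<in> X}"
  proof (rule vec.subspaceI)
    show "0 \<in> {v. v - N *v v \<in> X}" using X by (simp add: vec.subspace_0)
    show "x + y \<in> {v. v - N *v v \<in> X}" if "x \<in> {v. v - N *v v \<in> X}" "y \<in> {v. v - N *v v \<in> X}" for x y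
      using vec.subspace_add[OF X, of "x - N *v x" "y - N *v y"] that
      by (simp add: algebra_simps)
    show "c *s x \<in> {v. v - N *v v \<in> X}" if "x \<in> {v. v - N *v v \<in> X}" for c x
      using vec.subspace_scale[OF X, of "x - N *v x" c] that
      by (simp add: vec.scale_right_diff_distrib vec.scale)
  qed
  have "e \<subseteq> {v. v - N *v v \<in> X}"
    using e(2) n(2) X by (auto simp: N vec.subspace_0)
  then have "vec.span e \<subseteq> {v. v - N *v v \<in> X}"
    using sub by (rule vec.span_minimal)
  then show ?thesis using range spane by blast
qed

text \<open>A subspace \<open>B\<close> of maximal dimension among those containing \<open>A\<close>
  with the same trace on \<open>X\<close> works: a vector outside \<open>X + B\<close> could be
  added to it without changing that trace.\<close>

lemma exists_complement_extension:
  fixes X A :: "('a::field^'m) set"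
  assumes X: "vec.subspace X" and A: "vec.subspace A"
  shows "\<exists>B. vec.subspace B \<and> A \<subseteq> B \<and> X \<inter> B = X \<inter> A \<and> {x + b | x b. x \<in> X \<and> b \<in> B} = UNIV"
proof -
  let ?P = "\<lambda>B. vec.subspace B \<and> A \<subseteq> B \<and> X \<inter> B = X \<inter> A"
  have "?P A" using A by auto
  moreover have "\<forall>B. ?P B \<longrightarrow> vec.dim B < CARD('m) + 1"
    using dim_le_CARD by (auto simp: less_Suc_eq_le)
  ultimately obtain B where B: "?P B" and max: "\<And>C. ?P C \<Longrightarrow> vec.dim C \<le> vec.dim B"
    using ex_has_greatest_nat[of ?P A vec.dim "CARD('m) + 1"] by auto
  have "v \<in> {x + b | x b. x \<in> X \<and> b \<in> B}" for v
  proof (rule ccontr)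
    assume v: "v \<notin> {x + b | x b. x \<in> X \<and> b \<in> B}"
    have "v \<notin> B" using v vec.subspace_0[OF X] by (metis (mono_tags, lifting) CollectI add_0)
    have "X \<inter> vec.span (insert v B) \<subseteq> B"
    proof
      fix x assume x: "x \<in> X \<inter> vec.span (insert v B)"
      then obtain k where k: "x - k *s v \<in> B"
        using B by (metis IntD2 vec.span_breakdown_eq vec.span_eq_iff)
      \<comment> \<open>A nonzero coefficient would allow solving for \<open>v\<close> as an element
        of \<open>X + B\<close>.\<close>
      have "k = 0"
      proof (rule ccontr)
        assume "k \<noteq> 0"
        then have "v = (1/k) *s x + (- (1/k)) *s (x - k *s v)"
          by (simp add: vec_eq_iff field_simps)
        moreover have "(1/k) *s x \<in> X" "(- (1/k)) *s (x - k *s v) \<in> B"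
          using x k X B by (blast intro: vec.subspace_scale)+
        ultimately show False using v by blast
      qed
      then show "x \<in> B" using k by simp
    qed
    moreover have "B \<subseteq> vec.span (insert v B)"
      by (meson subset_insertI subset_trans vec.span_superset)
    ultimately have "?P (vec.span (insert v B))" using B by auto
    then have "vec.dim (insert v B) \<le> vec.dim B" using max by fastforce
    moreover have "v \<notin> vec.span B" using \<open>v \<notin> B\<close> B by (metis vec.span_eq_iff)
    ultimately show False by (simp add: vec.dim_insert)
  qed
  then show ?thesis using B by blast
qed

lemma dim_translate:
  fixes R :: "'a::field^'m^'m"
  assumes "det R \<noteq> 0"
  shows "vec.dim ((*v) R ` S) = vec.dim S"
proof -
  have "inj ((*v) R)" using assms by (simp add: inj_matrix_vector_mult invertible_det_nz)
  then show ?thesis by (intro vec.dim_image_eq) (auto intro: inj_on_subset)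
qed

text \<open>Openness of the rank condition: the determinants that detect it are those of
  \<open>R ** Q + N\<close>, where \<open>N\<close> ranges over maps onto small subspaces containing \<open>A\<close>.\<close>

lemma dim_translate_Int_le_iff:
  fixes R :: "'a::field^'m^'m"
  assumes R: "det R \<noteq> 0" and W: "vec.subspace W" and A: "vec.subspace A"
  shows "vec.dim ((*v) R ` W \<inter> A) \<le> k \<longleftrightarrow>
    (\<exists>Q N. range ((*v) Q) \<subseteq> W \<and> A \<subseteq> range ((*v) N) \<and>
       vec.dim W + vec.dim (range ((*v) N)) \<le> CARD('m) + k \<and> det (R ** Q + N) \<noteq> 0)"
    (is "_ \<longleftrightarrow> ?rhs")
proof -
  let ?X = "(*v) R ` W"
  have X: "vec.subspace ?X" using W by (rule vec.subspace_image)
  have dimX: "vec.dim ?X = vec.dim W" using R by (rule dim_translate)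
  show ?thesis
  proof
    assume le: "vec.dim (?X \<inter> A) \<le> k"
    obtain B where B: "vec.subspace B" "A \<subseteq> B" "?X \<inter> B = ?X \<inter> A"
        "{x + b | x b. x \<in> ?X \<and> b \<in> B} = UNIV"
      using exists_complement_extension[OF X A] by blast
    obtain N where N: "range ((*v) N) = B" "\<forall>v. v - N *v v \<in> ?X"
      using exists_projection_matrix[OF B(1) X B(4)] by blast
    obtain R' where R': "R ** R' = mat 1" "R' ** R = mat 1"
      using R by (metis invertible_det_nz invertible_def)
    \<comment> \<open>Solves \<open>R ** Q + N = mat 1\<close>; its values lie in \<open>W\<close>
      because \<open>v - N *v v\<close> always lies in the translate of \<open>W\<close>.\<close>
    define Q where "Q = R' ** (mat 1 - N)"
    have "Q *v v \<in> W" for v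
    proof -
      obtain w where w: "w \<in> W" "v - N *v v = R *v w" using N(2) by blast
      have "Q *v v = R' *v (v - N *v v)"
        by (simp add: Q_def matrix_vector_mul_assoc[symmetric] matrix_vector_mult_diff_rdistrib)
      also have "\<dots> = w" using w R' by (simp add: matrix_vector_mul_assoc)
      finally show ?thesis using w by simp
    qed
    moreover have "R ** Q + N = mat 1"
      using R' by (simp add: Q_def matrix_mul_assoc)
    \<comment> \<open>The translate of \<open>W\<close> and \<open>B\<close> span everything and
      meet only in the original intersection, so the dimension formula applies.\<close>
    moreover have "vec.dim W + vec.dim B \<le> CARD('m) + k"
      using vec.dim_sums_Int[OF X B(1)] le B(3,4) dimX by (simp add: card_cart_basis)
    ultimately show ?rhs using N B(2) by (intro exI[of _ Q] exI[of _ N]) auto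
  next
    assume ?rhs
    then obtain Q N where QN: "range ((*v) Q) \<subseteq> W" "A \<subseteq> range ((*v) N)"
       "vec.dim W + vec.dim (range ((*v) N)) \<le> CARD('m) + k" "det (R ** Q + N) \<noteq> 0" by blast
    let ?B = "range ((*v) N)"
    have B: "vec.subspace ?B" by (intro vec.subspace_image vec.subspace_UNIV)
    \<comment> \<open>Conversely, invertibility forces the translate of \<open>W\<close> and the
      range of \<open>N\<close> to span the space, which bounds their intersection from
      above.\<close>
    have surj: "surj ((*v) (R ** Q + N))"
      using QN(4) by (metis invertible_det_nz invertible_def matrix_right_invertible_surjective)
    have "v \<in> {x + b | x b. x \<in> ?X \<and> b \<in> ?B}" for v
    proof -
      obtain u where "v = (R ** Q + N) *v u" using surj by (metis surjD)
      then have "v = R *v (Q *v u) + N *v u"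
        by (simp add: matrix_vector_mult_add_rdistrib matrix_vector_mul_assoc)
      then show ?thesis using QN(1) by blast
    qed
    then have "{x + b | x b. x \<in> ?X \<and> b \<in> ?B} = UNIV" by blast
    then have "vec.dim (?X \<inter> ?B) \<le> k"
      using vec.dim_sums_Int[OF X B] QN(3) dimX by (simp add: card_cart_basis)
    moreover have "vec.dim (?X \<inter> A) \<le> vec.dim (?X \<inter> ?B)"
      using QN(2) by (intro vec.dim_subset) auto
    ultimately show "vec.dim (?X \<inter> A) \<le> k" by linarith
  qed
qed

section \<open>Connected groups and generic intersections\<close>

locale connected_rep =
  fixes H :: "('a::field^'n^'n) set" and \<rho> :: "'a^'n^'n \<Rightarrow> 'a^'m^'m"
  assumes group: "linear_algebraic_group H"
    and connected: "connectedin zariski H"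
    and rep: "regular_rep H \<rho>"
begin

lemma one_mem: "mat 1 \<in> H"
  and mult_mem: "g \<in> H \<Longrightarrow> h \<in> H \<Longrightarrow> g ** h \<in> H"
  and inverse_ex: "g \<in> H \<Longrightarrow> \<exists>g'\<in>H. g ** g' = mat 1 \<and> g' ** g = mat 1"
  and det_nonzero: "\<forall>g\<in>H. det g \<noteq> 0"
  using group unfolding linear_algebraic_group_def by auto

lemma det_rho: "g \<in> H \<Longrightarrow> det (\<rho> g) \<noteq> 0"
  and rho_mult: "g \<in> H \<Longrightarrow> h \<in> H \<Longrightarrow> \<rho> (g ** h) = \<rho> g ** \<rho> h"
  and rho_entry: "regular_fun_on H (\<lambda>g. \<rho> g $ i $ j)"
  using rep unfolding regular_rep_def by auto

text \<open>An invertible idempotent is the identity.\<close>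

lemma rho_one: "\<rho> (mat 1) = mat 1"
proof -
  have "\<rho> (mat 1) ** \<rho> (mat 1) = \<rho> (mat 1)"
    using rho_mult[OF one_mem one_mem] by simp
  moreover obtain B where "B ** \<rho> (mat 1) = mat 1"
    using det_rho[OF one_mem] by (metis invertible_det_nz invertible_def)
  ultimately show ?thesis by (metis matrix_mul_assoc matrix_mul_lid)
qed

section \<open>Closed subsets of \<open>H\<close> cut out by determinants\<close>

definition detfuns :: "('a^'n^'n \<Rightarrow> 'a) set" where
  "detfuns = {\<lambda>h. det (P ** \<rho> h ** Q + N) | (P :: 'a^'m^'m) Q N. True}"

definition zeros :: "('a^'n^'n \<Rightarrow> 'a) set \<Rightarrow> ('a^'n^'n) set" where
  "zeros S = {h\<in>H. \<forall>f\<in>S. f h = 0}"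

definition detclosed :: "('a^'n^'n) set set" where
  "detclosed = {zeros S | S. S \<subseteq> detfuns}"

definition monomial_vector :: "'a^'n^'n \<Rightarrow> 'a^('m \<Rightarrow> ('m \<times> 'm) option)" where
  "monomial_vector h = (\<chi> t. monomial_eval t (\<rho> h))"

lemma regular_detfuns: "f \<in> detfuns \<Longrightarrow> regular_fun_on H f"
  unfolding detfuns_def det_def
  by (auto simp: matrix_matrix_mult_def sum_distrib_right
      intro!: regular_fun_on_sum det_nonzero regular_fun_on_mult regular_fun_on_const
        regular_fun_on_prod regular_fun_on_add[OF det_nonzero] rho_entry)

lemma detclosed_zariski: "C \<in> detclosed \<Longrightarrow> \<exists>Z. zariski_closed Z \<and> C = H \<inter> Z"
  using zariski_closed_regular_zeros[OF det_nonzero] regular_detfuns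
  unfolding detclosed_def zeros_def by blast

lemma detclosed_Int:
  assumes "A \<in> detclosed" "B \<in> detclosed" shows "A \<inter> B \<in> detclosed"
proof -
  obtain S T where "S \<subseteq> detfuns" "T \<subseteq> detfuns" "A = zeros S" "B = zeros T"
    using assms unfolding detclosed_def by auto
  then show ?thesis
    unfolding detclosed_def by (auto simp: zeros_def intro!: exI[of _ "S \<union> T"])
qed

lemma H_detclosed: "H \<in> detclosed" "detclosed \<subseteq> Pow H"
  unfolding detclosed_def by (auto simp: zeros_def intro!: exI[of _ "{}"])

text \<open>A function in \<open>detfuns\<close> is a linear functional of
  \<open>monomial_vector\<close>. One that vanishes on \<open>A\<close> but not at a point of
  \<open>B\<close> gives a subspace \<open>K\<close> separating the two spans. This dimension serves
  as the measure \<open>\<mu>\<close> of the decomposition.\<close>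

lemma dim_monomial_vector_less:
  assumes "A \<in> detclosed" "B \<in> detclosed" "A \<subset> B"
  shows "vec.dim (monomial_vector ` A) < vec.dim (monomial_vector ` B)"
proof (rule vec.dim_psubset)
  obtain x where x: "x \<in> B" "x \<notin> A" using assms by auto
  have "x \<in> H" using x assms H_detclosed by auto
  then obtain f where f: "f \<in> detfuns" "\<And>a. a \<in> A \<Longrightarrow> f a = 0" "f x \<noteq> 0"
    using assms(1) x(2) unfolding detclosed_def zeros_def by blast
  then obtain P Q N :: "'a^'m^'m" where PQN: "f = (\<lambda>h. det (P ** \<rho> h ** Q + N))"
    unfolding detfuns_def by blast
  obtain c where c: "\<And>R. det (P ** R ** Q + N) = (\<Sum>t\<in>UNIV. c t * monomial_eval t R)"
    using det_affine_monomial_expansion by blast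
  define K where "K = {v. (\<Sum>t\<in>UNIV. c t * v $ t) = 0}"
  have "vec.subspace K"
    unfolding K_def
    by (rule vec.subspaceI)
      (auto simp: distrib_left sum.distrib mult.left_commute[of _ "_::'a"] sum_distrib_left[symmetric])
  moreover have fK: "f h = 0 \<longleftrightarrow> monomial_vector h \<in> K" for h
    unfolding PQN c K_def monomial_vector_def by simp
  ultimately have "vec.span (monomial_vector ` A) \<subseteq> K"
    using f(2) by (intro vec.span_minimal) auto
  then have "monomial_vector x \<notin> vec.span (monomial_vector ` A)" using fK f(3) by auto
  moreover have "monomial_vector x \<in> vec.span (monomial_vector ` B)"
    using x by (auto intro: vec.span_base)
  moreover have "vec.span (monomial_vector ` A) \<subseteq> vec.span (monomial_vector ` B)"
    using assms by (intro vec.span_mono) auto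
  ultimately show "vec.span (monomial_vector ` A) \<subset> vec.span (monomial_vector ` B)" by blast
qed

text \<open>Translating by \<open>g\<close> means substituting \<open>g' ** h\<close> in the
  equations, and the factor \<open>\<rho> g'\<close> is absorbed into the left matrix
  \<open>P\<close>. This is why \<open>detfuns\<close> carries a left factor.\<close>

lemma detclosed_translate:
  assumes g: "g \<in> H" "g' \<in> H" "g ** g' = mat 1" "g' ** g = mat 1" and A: "A \<in> detclosed"
  shows "(**) g ` A \<in> detclosed"
proof -
  obtain S where S: "S \<subseteq> detfuns" "A = zeros S" using A unfolding detclosed_def by auto
  have cancel: "g ** (g' ** h) = h" "g' ** (g ** h) = h" for h
    using g by (simp_all add: matrix_mul_assoc)
  define S' where "S' = {\<lambda>h. det (P ** \<rho> g' ** \<rho> h ** Q + N) | (P :: 'a^'m^'m) Q N.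
    (\<lambda>h. det (P ** \<rho> h ** Q + N)) \<in> S}"
  have "S' \<subseteq> detfuns" unfolding S'_def detfuns_def by blast
  have iff: "h \<in> zeros S' \<longleftrightarrow> g' ** h \<in> zeros S" if "h \<in> H" for h
  proof -
    have "(\<forall>f\<in>S'. f h = 0) \<longleftrightarrow> (\<forall>(P :: 'a^'m^'m) Q N. (\<lambda>h. det (P ** \<rho> h ** Q + N)) \<in> S \<longrightarrow>
        det (P ** \<rho> (g' ** h) ** Q + N) = 0)"
      unfolding S'_def rho_mult[OF g(2) that] by (auto simp: matrix_mul_assoc)
    also have "\<dots> \<longleftrightarrow> (\<forall>f\<in>S. f (g' ** h) = 0)"
      using S(1) unfolding detfuns_def by fastforce
    finally show ?thesis
      unfolding zeros_def using that mult_mem[OF g(2) that] by simp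
  qed
  have "(**) g ` A = zeros S'"
  proof (intro equalityI subsetI)
    fix y assume "y \<in> (**) g ` A"
    then obtain a where a: "a \<in> zeros S" "y = g ** a" using S by auto
    then have "a \<in> H" unfolding zeros_def by auto
    then show "y \<in> zeros S'" using iff[of y] a mult_mem[OF g(1)] by (simp add: cancel)
  next
    fix y assume y: "y \<in> zeros S'"
    then have "y \<in> H" unfolding zeros_def by auto
    then have "g' ** y \<in> A" using iff y S by auto
    then show "y \<in> (**) g ` A" by (metis cancel(1) imageI)
  qed
  then show ?thesis using \<open>S' \<subseteq> detfuns\<close> unfolding detclosed_def by auto
qed

text \<open>Finite unions may leave \<open>detclosed\<close> but remain relatively Zariski closed,
  which is what connectedness can be applied to.\<close>

lemma closedin_Union_detclosed:
  assumes "finite F" "F \<subseteq> detclosed"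
  shows "\<exists>Z. closedin zariski Z \<and> \<Union>F = H \<inter> Z"
proof -
  obtain Z where Z: "\<And>C. C \<in> F \<Longrightarrow> zariski_closed (Z C) \<and> C = H \<inter> Z C"
    using detclosed_zariski assms(2) by (metis subsetD)
  have "\<Union>F = H \<inter> (\<Union>C\<in>F. Z C)" using Z by auto
  moreover have "closedin zariski (\<Union>C\<in>F. Z C)"
    using assms(1) Z by (intro closedin_Union) (auto simp: closedin_zariski)
  ultimately show ?thesis by blast
qed

text \<open>Left translations act transitively, so \<open>H\<close> is a finite disjoint union of
  irreducible members. Connectedness leaves room for only one.\<close>

lemma H_irreducible: "irreducible_in detclosed H"
proof -
  have hom: "\<exists>\<sigma> \<tau>. \<sigma> y = x \<and> (\<forall>A\<in>detclosed. \<sigma> ` A \<in> detclosed \<and> \<tau> ` A \<in> detclosed) \<and>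
      (\<forall>z\<in>H. \<sigma> (\<tau> z) = z \<and> \<tau> (\<sigma> z) = z)" if xy: "x \<in> H" "y \<in> H" for x y
  proof -
    obtain x' y' where x': "x' \<in> H" "x ** x' = mat 1" "x' ** x = mat 1"
        and y': "y' \<in> H" "y ** y' = mat 1" "y' ** y = mat 1"
      using inverse_ex xy by metis
    \<comment> \<open>Mutually inverse elements of \<open>H\<close>, with left translation by
      \<open>g\<close> carrying \<open>y\<close> to \<open>x\<close>.\<close>
    define g g' where "g = x ** y'" and "g' = y ** x'"
    have mem: "g \<in> H" "g' \<in> H" unfolding g_def g'_def using mult_mem xy x' y' by auto
    have gg: "g ** g' = mat 1"
    proof -
      have "g ** g' = x ** (y' ** y) ** x'" by (simp add: g_def g'_def matrix_mul_assoc)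
      then show ?thesis using x' y' by simp
    qed
    have g'g: "g' ** g = mat 1"
    proof -
      have "g' ** g = y ** (x' ** x) ** y'" by (simp add: g_def g'_def matrix_mul_assoc)
      then show ?thesis using x' y' by simp
    qed
    have "g ** y = x" using y' by (simp add: g_def matrix_mul_assoc[symmetric])
    then show ?thesis
      using detclosed_translate[OF mem gg g'g] detclosed_translate[OF mem(2,1) g'g gg] gg g'g
      by (intro exI[of _ "(**) g"] exI[of _ "(**) g'"]) (auto simp: matrix_mul_assoc)
  qed
  obtain M where M: "finite M" "\<forall>X\<in>M. irreducible_in detclosed X" "H = \<Union>M" "disjoint M"
    using disjoint_irreducible_decomposition[where \<mu> = "\<lambda>A. vec.dim (monomial_vector ` A)",
        OF detclosed_Int dim_monomial_vector_less H_detclosed hom] by blast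
  obtain X where X: "X \<in> M" using one_mem M(3) by auto
  have MC: "M \<subseteq> detclosed" using M(2) unfolding irreducible_in_def by auto
  have "X = H"
  proof (rule ccontr)
    assume "X \<noteq> H"
    obtain Z where Z: "closedin zariski Z" "X = H \<inter> Z"
      using closedin_Union_detclosed[of "{X}"] X MC by auto
    obtain Y where Y: "closedin zariski Y" "\<Union>(M - {X}) = H \<inter> Y"
      using closedin_Union_detclosed[of "M - {X}"] M(1) MC by auto
    have "X \<inter> \<Union>(M - {X}) = {}"
      using M(4) X by (auto simp: disjoint_def)
    moreover have "X \<union> \<Union>(M - {X}) = H" using M(3) X by auto
    moreover have "X \<noteq> {}" using irreducible_in_nonempty M(2) X by blast
    \<comment> \<open>The set cut out by \<open>Y\<close> is the complement of \<open>X\<close> in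
      \<open>H\<close>, nonempty because \<open>X\<close> is proper.\<close>
    ultimately have "H \<subseteq> Z \<union> Y" "Z \<inter> Y \<inter> H = {}" "Z \<inter> H \<noteq> {}" "Y \<inter> H \<noteq> {}"
      using Z(2) Y(2) \<open>X \<noteq> H\<close> by auto
    then show False using connected Z(1) Y(1) unfolding connectedin_closedin by blast
  qed
  then show ?thesis using M(2) X by auto
qed

section \<open>Generic dimension of an intersection\<close>

abbreviation meet_dim :: "('a^'m) set \<Rightarrow> ('a^'m) set \<Rightarrow> 'a^'n^'n \<Rightarrow> nat" where
  "meet_dim W A h \<equiv> vec.dim ((*v) (\<rho> h) ` W \<inter> A)"

lemma detclosed_meet_dim_greater:
  assumes "vec.subspace W" "vec.subspace A"
  shows "{h\<in>H. \<not> meet_dim W A h \<le> k} \<in> detclosed"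
proof -
  define T where "T = {(Q :: 'a^'m^'m, N :: 'a^'m^'m). range ((*v) Q) \<subseteq> W \<and> A \<subseteq> range ((*v) N) \<and>
    vec.dim W + vec.dim (range ((*v) N)) \<le> CARD('m) + k}"
  \<comment> \<open>The factor \<open>mat 1\<close> puts these determinants literally in the form
    used by \<open>detfuns\<close>.\<close>
  define S where "S = (\<lambda>(Q, N) h. det (mat 1 ** \<rho> h ** Q + N)) ` T"
  have "\<not> meet_dim W A h \<le> k \<longleftrightarrow> (\<forall>f\<in>S. f h = 0)" if "h \<in> H" for h
    unfolding dim_translate_Int_le_iff[OF det_rho[OF that] assms] S_def T_def by auto
  then have "{h\<in>H. \<not> meet_dim W A h \<le> k} = zeros S"
    unfolding zeros_def by (intro Collect_cong conj_cong refl)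
  moreover have "S \<subseteq> detfuns" unfolding S_def detfuns_def by (auto simp del: matrix_mul_lid)
  ultimately show ?thesis unfolding detclosed_def by blast
qed

lemma openin_meet_dim_le:
  assumes "vec.subspace W" "vec.subspace A"
  shows "openin (subtopology zariski H) {h\<in>H. meet_dim W A h \<le> k}"
proof -
  obtain Z where Z: "zariski_closed Z" "{h\<in>H. \<not> meet_dim W A h \<le> k} = H \<inter> Z"
    using detclosed_zariski[OF detclosed_meet_dim_greater[OF assms]] by blast
  have "{h\<in>H. meet_dim W A h \<le> k} = - Z \<inter> H" using Z(2) by blast
  then show ?thesis
    using Z(1) by (auto simp: openin_subtopology openin_zariski intro!: exI[of _ "- Z"])
qed

definition generic_dim :: "('a^'m) set \<Rightarrow> ('a^'m) set \<Rightarrow> nat" where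
  "generic_dim W A = (LEAST k. \<exists>h\<in>H. meet_dim W A h = k)"

lemma generic_dim_attained: "\<exists>h\<in>H. meet_dim W A h = generic_dim W A"
  unfolding generic_dim_def by (rule LeastI_ex) (use one_mem in blast)

lemma generic_dim_le: "h \<in> H \<Longrightarrow> generic_dim W A \<le> meet_dim W A h"
  unfolding generic_dim_def by (rule Least_le) blast

text \<open>Each set of exceptional \<open>h\<close> is a proper member of \<open>detclosed\<close>,
  and two such sets cannot cover the irreducible \<open>H\<close>.\<close>

lemma generic_dim_attained_simultaneously:
  assumes W: "vec.subspace W" and "vec.subspace A" "vec.subspace B"
  shows "\<exists>h\<in>H. meet_dim W A h = generic_dim W A \<and> meet_dim W B h = generic_dim W B"
proof -
  let ?E = "\<lambda>A. {h\<in>H. \<not> meet_dim W A h \<le> generic_dim W A}"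
  have "\<not> H \<subseteq> ?E A" "\<not> H \<subseteq> ?E B"
    using generic_dim_attained[of W A] generic_dim_attained[of W B] by auto
  moreover have "?E A \<in> detclosed" "?E B \<in> detclosed"
    using detclosed_meet_dim_greater assms by auto
  ultimately have "\<not> H \<subseteq> \<Union>{?E A, ?E B}"
    using H_irreducible unfolding irreducible_in_def
    by (metis (no_types, lifting) empty_subsetI finite.emptyI finite_insert insert_iff insert_subset singletonD)
  then obtain h where "h \<in> H" "meet_dim W A h \<le> generic_dim W A" "meet_dim W B h \<le> generic_dim W B"
    by auto
  then show ?thesis using generic_dim_le by (meson le_antisym)
qed

text \<open>Take \<open>h\<close> generic for both the sum and the intersection. The dimension
  formula compares the four meets at this \<open>h\<close>, whose values for \<open>A\<close> and
  \<open>B\<close> are at least the generic ones.\<close>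

lemma generic_dim_supermodular:
  assumes W: "vec.subspace W" and A: "vec.subspace A" and B: "vec.subspace B"
  shows "generic_dim W A + generic_dim W B
    \<le> generic_dim W {a + b | a b. a \<in> A \<and> b \<in> B} + generic_dim W (A \<inter> B)"
proof -
  let ?S = "{a + b | a b. a \<in> A \<and> b \<in> B}"
  have "vec.subspace ?S" "vec.subspace (A \<inter> B)"
    using A B by (auto intro: vec.subspace_sums vec.subspace_inter)
  then obtain h where h: "h \<in> H" "meet_dim W ?S h = generic_dim W ?S"
      "meet_dim W (A \<inter> B) h = generic_dim W (A \<inter> B)"
    using generic_dim_attained_simultaneously[OF W] by blast
  let ?X = "(*v) (\<rho> h) ` W"
  have X: "vec.subspace ?X" using W by (rule vec.subspace_image)
  have "{x + y | x y. x \<in> ?X \<inter> A \<and> y \<in> ?X \<inter> B} \<subseteq> ?X \<inter> ?S"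
    using vec.subspace_add[OF X] by blast
  then have "vec.dim {x + y | x y. x \<in> ?X \<inter> A \<and> y \<in> ?X \<inter> B} \<le> meet_dim W ?S h"
    by (rule vec.dim_subset)
  moreover have "?X \<inter> A \<inter> (?X \<inter> B) = ?X \<inter> (A \<inter> B)" by auto
  ultimately have "meet_dim W A h + meet_dim W B h \<le> meet_dim W ?S h + meet_dim W (A \<inter> B) h"
    using vec.dim_sums_Int[OF vec.subspace_inter[OF X A] vec.subspace_inter[OF X B]] by simp
  then show ?thesis
    using h generic_dim_le[OF h(1), of W A] generic_dim_le[OF h(1), of W B] by linarith
qed

text \<open>The inverse of \<open>\<rho> g\<close> carries the meet of the translate of
  \<open>A\<close> at \<open>h\<close> onto the meet of \<open>A\<close> at \<open>g' ** h\<close>,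
  so every value taken for the translate is also taken for \<open>A\<close>.\<close>

lemma generic_dim_translate_ge:
  assumes g: "g \<in> H"
  shows "generic_dim W A \<le> generic_dim W ((*v) (\<rho> g) ` A)"
proof -
  obtain g' where g': "g' \<in> H" "g ** g' = mat 1" "g' ** g = mat 1" using inverse_ex g by blast
  have "\<rho> g' ** \<rho> g = mat 1" "\<rho> g ** \<rho> g' = mat 1"
    using rho_mult[OF g g'(1)] rho_mult[OF g'(1) g] g'(2,3) rho_one by metis+
  then have cancel: "\<rho> g' *v (\<rho> g *v v) = v" "\<rho> g *v (\<rho> g' *v v) = v" for v
    by (simp_all add: matrix_vector_mul_assoc)
  obtain h where h: "h \<in> H" "meet_dim W ((*v) (\<rho> g) ` A) h = generic_dim W ((*v) (\<rho> g) ` A)"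
    using generic_dim_attained by blast
  have "(*v) (\<rho> g') ` ((*v) (\<rho> h) ` W \<inter> (*v) (\<rho> g) ` A) = (*v) (\<rho> (g' ** h)) ` W \<inter> A"
  proof (intro equalityI subsetI)
    fix v assume "v \<in> (*v) (\<rho> g') ` ((*v) (\<rho> h) ` W \<inter> (*v) (\<rho> g) ` A)"
    then show "v \<in> (*v) (\<rho> (g' ** h)) ` W \<inter> A"
      by (auto simp: rho_mult[OF g'(1) h(1)] cancel matrix_vector_mul_assoc[symmetric])
  next
    fix v assume v: "v \<in> (*v) (\<rho> (g' ** h)) ` W \<inter> A"
    then obtain w where w: "w \<in> W" "v = \<rho> g' *v (\<rho> h *v w)"
      by (auto simp: rho_mult[OF g'(1) h(1)] matrix_vector_mul_assoc)
    then have "\<rho> g *v v = \<rho> h *v w" by (simp add: cancel)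
    then have "\<rho> g *v v \<in> (*v) (\<rho> h) ` W \<inter> (*v) (\<rho> g) ` A" using v w(1) by blast
    then show "v \<in> (*v) (\<rho> g') ` ((*v) (\<rho> h) ` W \<inter> (*v) (\<rho> g) ` A)"
      using cancel(1) by (metis imageI)
  qed
  then have "meet_dim W A (g' ** h) = meet_dim W ((*v) (\<rho> g) ` A) h"
    using dim_translate[OF det_rho[OF g'(1)]] by metis
  then show ?thesis using generic_dim_le[OF mult_mem[OF g'(1) h(1)], of W A] h by simp
qed

lemma generic_dim_bound:
  assumes irr: "irreducible_rep H \<rho>" and W: "vec.subspace W" and A: "vec.subspace A"
  shows "CARD('m) * generic_dim W A \<le> vec.dim W * vec.dim A"
proof -
  let ?m = "CARD('m)"
  have dim_le: "vec.dim S \<le> ?m" for S :: "('a^'m) set"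
    by (rule dim_le_CARD)
  \<comment> \<open>The claim is that \<open>\<phi>\<close> is nonpositive at \<open>A\<close>;
    integers permit the subtraction.\<close>
  define \<phi> where "\<phi> B = int ?m * int (generic_dim W B) - int (vec.dim W) * int (vec.dim B)" for B
  have gen_le: "generic_dim W B \<le> ?m" for B
    using generic_dim_attained[of W B] dim_le by metis
  have \<phi>_bounds: "\<phi> B \<ge> - int (?m * ?m)" "\<phi> B \<le> int (?m * ?m)" for B
  proof -
    have "vec.dim W * vec.dim B \<le> ?m * ?m" "?m * generic_dim W B \<le> ?m * ?m"
      using dim_le gen_le by (auto intro: mult_mono)
    then have "int (vec.dim W) * int (vec.dim B) \<le> int (?m * ?m)"
        "int ?m * int (generic_dim W B) \<le> int (?m * ?m)"
      by (metis of_nat_le_iff of_nat_mult)+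
    moreover have "int (vec.dim W) * int (vec.dim B) \<ge> 0" "int ?m * int (generic_dim W B) \<ge> 0" by simp_all
    ultimately show "\<phi> B \<ge> - int (?m * ?m)" "\<phi> B \<le> int (?m * ?m)" unfolding \<phi>_def by linarith+
  qed
  obtain B0 where B0: "vec.subspace B0" "\<And>C. vec.subspace C \<Longrightarrow> \<phi> C \<le> \<phi> B0"
  proof -
    \<comment> \<open>Shifting by the lower bound turns \<open>\<phi>\<close> into a bounded
      natural-valued function, which has a maximum.\<close>
    have "\<forall>B. vec.subspace B \<longrightarrow> nat (\<phi> B + int (?m * ?m)) < 2 * (?m * ?m) + 1"
    proof (intro allI impI)
      fix B show "nat (\<phi> B + int (?m * ?m)) < 2 * (?m * ?m) + 1"
        using \<phi>_bounds[of B] by linarith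
    qed
    then obtain B0 where "vec.subspace B0"
        "\<And>C. vec.subspace C \<Longrightarrow> nat (\<phi> C + int (?m * ?m)) \<le> nat (\<phi> B0 + int (?m * ?m))"
      using ex_has_greatest_nat[of vec.subspace A "\<lambda>B. nat (\<phi> B + int (?m * ?m))"] A by blast
    moreover have "\<phi> C \<le> \<phi> B0"
      if "nat (\<phi> C + int (?m * ?m)) \<le> nat (\<phi> B0 + int (?m * ?m))" for C
      using that \<phi>_bounds[of C] \<phi>_bounds[of B0] by linarith
    ultimately show ?thesis using that by blast
  qed
  \<comment> \<open>A second maximisation, of dimension among the maximisers of
    \<open>\<phi>\<close>: any maximiser containing \<open>B\<close> must then equal
    \<open>B\<close>.\<close>
  let ?P = "\<lambda>B. vec.subspace B \<and> \<phi> B = \<phi> B0"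
  have "\<forall>B. ?P B \<longrightarrow> vec.dim B < ?m + 1" using dim_le by (simp add: le_imp_less_Suc)
  then obtain B where B: "vec.subspace B" "\<phi> B = \<phi> B0"
      and dim_max: "\<And>C. ?P C \<Longrightarrow> vec.dim C \<le> vec.dim B"
    using ex_has_greatest_nat[of ?P B0 vec.dim] B0 by blast
  have max: "\<phi> C \<le> \<phi> B" if "vec.subspace C" for C using B0 B that by simp
  have "\<rho> g *v u \<in> B" if g: "g \<in> H" and u: "u \<in> B" for g u
  proof -
    let ?G = "(*v) (\<rho> g) ` B"
    let ?S = "{x + y | x y. x \<in> B \<and> y \<in> ?G}"
    have G: "vec.subspace ?G" using B(1) by (rule vec.subspace_image)
    have S: "vec.subspace ?S" using B(1) G by (rule vec.subspace_sums)
    have dimG: "vec.dim ?G = vec.dim B" using det_rho[OF g] by (rule dim_translate)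
    have "\<phi> B \<le> \<phi> ?G"
      using generic_dim_translate_ge[OF g, of W B] dimG unfolding \<phi>_def by (simp add: mult_left_mono)
    moreover have "\<phi> B + \<phi> ?G \<le> \<phi> ?S + \<phi> (B \<inter> ?G)"
    proof -
      have "int ?m * (int (generic_dim W B) + int (generic_dim W ?G))
          \<le> int ?m * (int (generic_dim W ?S) + int (generic_dim W (B \<inter> ?G)))"
        using generic_dim_supermodular[OF W B(1) G] by (intro mult_left_mono) linarith+
      \<comment> \<open>The dimension term is modular, so subtracting it preserves
        supermodularity.\<close>
      moreover have "int (vec.dim ?S) + int (vec.dim (B \<inter> ?G)) = int (vec.dim B) + int (vec.dim ?G)"
        using vec.dim_sums_Int[OF B(1) G] by linarith
      then have "int (vec.dim W) * (int (vec.dim ?S) + int (vec.dim (B \<inter> ?G)))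
          = int (vec.dim W) * (int (vec.dim B) + int (vec.dim ?G))"
        by (rule arg_cong)
      ultimately show ?thesis unfolding \<phi>_def by (simp add: algebra_simps)
    qed
    moreover have "\<phi> (B \<inter> ?G) \<le> \<phi> B" using max vec.subspace_inter[OF B(1) G] by blast
    \<comment> \<open>As the translate is at least as good as \<open>B\<close> and the intersection
      at most as good, the sum must be a maximiser too.\<close>
    ultimately have "\<phi> ?S = \<phi> B0" using max[OF S] B(2) by linarith
    then have "vec.dim ?S \<le> vec.dim B" using dim_max S by blast
    moreover have "B \<subseteq> ?S"
    proof
      fix b assume "b \<in> B"
      then have "b + 0 \<in> ?S" using vec.subspace_0[OF G] by blast
      then show "b \<in> ?S" by simp
    qed
    ultimately have "B = ?S" using vec.subspace_dim_equal[OF B(1) S] by blast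
    moreover have "0 + \<rho> g *v u \<in> ?S" using u vec.subspace_0[OF B(1)] by blast
    ultimately show ?thesis by simp
  qed
  then have "B = {0} \<or> B = UNIV"
    using irr B(1) unfolding irreducible_rep_def by blast
  \<comment> \<open>At zero both terms vanish; on the whole space the meet is the full translate of
    \<open>W\<close>, so they cancel.\<close>
  then have "\<phi> B = 0"
  proof
    assume "B = {0}"
    moreover have "generic_dim W {0} = 0"
      using generic_dim_attained[of W "{0}"] vec.dim_eq_0 by (metis inf.cobounded2)
    ultimately show ?thesis by (simp add: \<phi>_def)
  next
    assume "B = UNIV"
    moreover have "generic_dim W UNIV = vec.dim W"
      using generic_dim_attained[of W UNIV] dim_translate[OF det_rho] by auto
    ultimately show ?thesis by (simp add: \<phi>_def card_cart_basis)
  qed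
  then have "int ?m * int (generic_dim W A) \<le> int (vec.dim W) * int (vec.dim A)"
    using max[OF A] unfolding \<phi>_def by linarith
  then show ?thesis by (metis of_nat_le_iff of_nat_mult)
qed

end

theorem theorem1p11:
  fixes H :: "('a::field_char_0^'n^'n) set"
    and \<rho> :: "'a^'n^'n \<Rightarrow> 'a^'m^'m"
    and W W' :: "('a^'m) set"
  assumes "linear_algebraic_group H"
    and "connectedin zariski H"
    and "regular_rep H \<rho>"
    and "irreducible_rep H \<rho>"
    and "vec.subspace W" and "vec.subspace W'"
  shows "(\<exists>h\<in>H. real (vec.dim (((*v) (\<rho> h)) ` W \<inter> W'))
            \<le> real (vec.dim W) / real (vec.dim (UNIV :: ('a^'m) set)) * real (vec.dim W'))
       \<and> openin (subtopology zariski H)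
           {h\<in>H. real (vec.dim (((*v) (\<rho> h)) ` W \<inter> W'))
            \<le> real (vec.dim W) / real (vec.dim (UNIV :: ('a^'m) set)) * real (vec.dim W')}"
proof -
  interpret connected_rep H \<rho>
    using assms(1-3) by unfold_locales
  define r where "r = real (vec.dim W) / real (vec.dim (UNIV :: ('a^'m) set)) * real (vec.dim W')"
  have "r \<ge> 0" by (simp add: r_def)
  \<comment> \<open>Rounding down turns the real bound into the natural threshold of
    \<open>openin_meet_dim_le\<close>; \<open>r \<ge> 0\<close> keeps \<open>nat\<close> from
    truncating.\<close>
  then have nat_floor: "real k \<le> r \<longleftrightarrow> k \<le> nat \<lfloor>r\<rfloor>" for k by linarith
  obtain h where h: "h \<in> H" "meet_dim W W' h = generic_dim W W'"
    using generic_dim_attained by blast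
  have "real (CARD('m) * generic_dim W W') \<le> real (vec.dim W * vec.dim W')"
    using generic_dim_bound[OF assms(4-6)] by (simp only: of_nat_le_iff)
  then have "real (generic_dim W W') \<le> r"
    by (simp add: r_def card_cart_basis field_simps)
  then have "\<exists>h\<in>H. real (meet_dim W W' h) \<le> r" using h by metis
  moreover have "openin (subtopology zariski H) {h\<in>H. real (meet_dim W W' h) \<le> r}"
    unfolding nat_floor using assms(5,6) by (rule openin_meet_dim_le)
  ultimately show ?thesis unfolding r_def by blast
qed

end
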